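(* Let $\Phi:\mathbb{R}^n\to 2^{\mathbb{R}^n}$ be a set-valued mapping with nonempty, closed and convex values, and let $f:\mathbb{R}^n\to\mathbb{R}^n$ be $L$-Lipschitz continuous and $\beta$-strongly monotone ($\beta>0$). Let $\alpha>0$, and assume that there exists $\mu>0$ such that $$\|P_{\Phi(u)}(w)-P_{\Phi(v)}(w)\|\le \mu\|u-v\|\quad\text{for all } u,v,w\in\mathbb{R}^n,$$ and $$\sqrt{L^2+\alpha^2-2\alpha\beta}+\mu<\alpha .$$ Assume further that $$\sqrt{L^2+\alpha^2-2\alpha\beta}+\mu<\beta .$$ Let $\sigma>0$ and $\gamma>2$, and consider the dynamical system $$\dot u(t)=-\sigma\,\frac{f(u)-P_{\Phi(u)}(f(u)-\alpha u)}{\|f(u)-P_{\Phi(u)}(f(u)-\alpha u)\|^{\frac{\gamma-2}{\gamma-1}}},\qquad u=u(t).$$ Then the solution $u^*\in\mathbb{R}^n$ of the inverse quasi-variational inequality problem associated with $(f,\Phi)$ is a globally finite-time stable equilibrium point of this dynamical system, and there exist constants $K>0$ and $p\in(0.5,1)$ such that the settling time satisfies, for every initial point $u(0)$, $$T(u(0))\le T_{\max}=\frac{1}{2^{1-p}}\cdot\frac{\|u(0)-u^*\|^{2(1-p)}}{K(1-p)} .$$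
   Context: $\langle\cdot,\cdot\rangle$ and $\|\cdot\|$ are the inner product and norm of $\mathbb{R}^n$. For a nonempty closed convex set $C\subseteq\mathbb{R}^n$, $P_C(u)$ is the metric projection of $u$ onto $C$. The map $f$ is $L$-Lipschitz if $\|f(u)-f(v)\|\le L\|u-v\|$ and $\beta$-strongly monotone if $\langle f(u)-f(v),u-v\rangle\ge\beta\|u-v\|^2$ for all $u,v$. Inverse quasi-variational inequality problem (IQVIP) associated with $(f,\Phi)$: find $u^*\in\mathbb{R}^n$ such that $f(u^* )\in\Phi(u^* )$ and $\langle u^*,y-f(u^* )\rangle\ge 0$ for all $y\in\Phi(u^* )$. (Under the first group of hypotheses the IQVIP is known to have a unique solution.) The right-hand side of the dynamical system is understood to be $0$ at points $u$ with $f(u)-P_{\Phi(u)}(f(u)-\alpha u)=0$. Stability notions. Consider $\dot u(t)=G(u(t))$, $t\ge0$, with $G:\mathbb{R}^n\to\mathbb{R}^n$ continuous. A point $u^*$ is an equilibrium point if $G(u^* )=0$. It is finite-time stable if (i) it is Lyapunov stable: for every $\epsilon>0$ there is $\delta>0$ such that for every $u_0$ in the open ball $B(u^*,\delta)$ the solution with $u(0)=u_0$ exists and lies in $B(u^*,\epsilon)$ for all $t>0$; and (ii) there are a ball $B$ centered at $u^*$ and a settling-time function $T:B\setminus\{u^*\}\to(0,\infty)$ such that for every $u(0)\in B\setminus\{u^*\}$ the solution satisfies $u(t)\in B\setminus\{u^*\}$ for all $t\in[0,T(u(0)))$ and $\lim_{t\to T(u(0))}u(t)=u^*$. It is globally finite-time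 stable if it is finite-time stable with $B=\mathbb{R}^n$. *)

theory Defs
  imports "HOL-Analysis.Analysis"
begin

section \<open>Inverse quasi-variational inequalities\<close>

definition strongly_monotone :: "real \<Rightarrow> ('a::real_inner \<Rightarrow> 'a) \<Rightarrow> bool" where
  "strongly_monotone \<beta> f \<longleftrightarrow>
     (\<forall>u v. (f u - f v) \<bullet> (u - v) \<ge> \<beta> * (norm (u - v))\<^sup>2)"

definition iqvip_solution ::
    "('a::real_inner \<Rightarrow> 'a) \<Rightarrow> ('a \<Rightarrow> 'a set) \<Rightarrow> 'a \<Rightarrow> bool" where
  "iqvip_solution f \<Phi> u \<longleftrightarrow>
     f u \<in> \<Phi> u \<and> (\<forall>y\<in>\<Phi> u. u \<bullet> (y - f u) \<ge> 0)"

text \<open>The metric projection onto a nonempty closed convex set \<open>C\<close> is the library's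
  \<^const>\<open>closest_point\<close>.\<close>

definition iqvip_residual ::
    "('a::euclidean_space \<Rightarrow> 'a) \<Rightarrow> ('a \<Rightarrow> 'a set) \<Rightarrow> real \<Rightarrow> 'a \<Rightarrow> 'a" where
  "iqvip_residual f \<Phi> \<alpha> u = f u - closest_point (\<Phi> u) (f u - \<alpha> *\<^sub>R u)"

definition iqvip_field ::
    "('a::euclidean_space \<Rightarrow> 'a) \<Rightarrow> ('a \<Rightarrow> 'a set) \<Rightarrow> real \<Rightarrow> real \<Rightarrow> real \<Rightarrow> 'a \<Rightarrow> 'a" where
  "iqvip_field f \<Phi> \<alpha> \<sigma> \<gamma> u =
     (let r = iqvip_residual f \<Phi> \<alpha> u in
        if r = 0 then 0
        else - (\<sigma> *\<^sub>R (r /\<^sub>R (norm r powr ((\<gamma> - 2) / (\<gamma> - 1))))))"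


section \<open>Finite-time stability of autonomous systems\<close>

definition ivp_solution_on ::
    "real set \<Rightarrow> ('a::real_normed_vector \<Rightarrow> 'a) \<Rightarrow> 'a \<Rightarrow> (real \<Rightarrow> 'a) \<Rightarrow> bool" where
  "ivp_solution_on I G u0 u \<longleftrightarrow>
     u 0 = u0 \<and> (\<forall>t\<in>I. (u has_vector_derivative G (u t)) (at t within I))"

text \<open>``The'' solution starting at \<open>u0\<close>: it exists for all \<open>t \<ge> 0\<close>, and every other
  solution, even one that only exists on some \<open>[0, \<tau>)\<close>, agrees with it. Values at
  negative times are irrelevant.\<close>

definition the_ivp_solution ::
    "('a::real_normed_vector \<Rightarrow> 'a) \<Rightarrow> 'a \<Rightarrow> (real \<Rightarrow> 'a) \<Rightarrow> bool" where
  "the_ivp_solution G u0 u \<longleftrightarrow>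
     ivp_solution_on {0..} G u0 u \<and>
     (\<forall>\<tau>>0. \<forall>v. ivp_solution_on {0..<\<tau>} G u0 v \<longrightarrow> (\<forall>t\<in>{0..<\<tau>}. v t = u t))"

definition equilibrium_point :: "('a::real_normed_vector \<Rightarrow> 'a) \<Rightarrow> 'a \<Rightarrow> bool" where
  "equilibrium_point G x \<longleftrightarrow> G x = 0"

definition lyapunov_stable :: "('a::real_normed_vector \<Rightarrow> 'a) \<Rightarrow> 'a \<Rightarrow> bool" where
  "lyapunov_stable G x \<longleftrightarrow>
     (\<forall>\<epsilon>>0. \<exists>\<delta>>0. \<forall>u0\<in>ball x \<delta>. \<exists>u. the_ivp_solution G u0 u \<and> (\<forall>t>0. u t \<in> ball x \<epsilon>))"

text \<open>Only the values of \<open>T\<close> on \<open>B - {x}\<close> matter.\<close>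

definition settling_time_function ::
    "('a::real_normed_vector \<Rightarrow> 'a) \<Rightarrow> 'a \<Rightarrow> 'a set \<Rightarrow> ('a \<Rightarrow> real) \<Rightarrow> bool" where
  "settling_time_function G x B T \<longleftrightarrow>
     (\<forall>u0\<in>B - {x}. T u0 > 0 \<and>
        (\<exists>u. the_ivp_solution G u0 u \<and>
             (\<forall>t\<in>{0..<T u0}. u t \<in> B - {x}) \<and>
             (u \<longlongrightarrow> x) (at_left (T u0))))"

definition finite_time_stable_in ::
    "('a::real_normed_vector \<Rightarrow> 'a) \<Rightarrow> 'a \<Rightarrow> 'a set \<Rightarrow> bool" where
  "finite_time_stable_in G x B \<longleftrightarrow>
     continuous_on UNIV G \<and> equilibrium_point G x \<and> lyapunov_stable G x \<and>
     (\<exists>T. settling_time_function G x B T)"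

definition finite_time_stable :: "('a::real_normed_vector \<Rightarrow> 'a) \<Rightarrow> 'a \<Rightarrow> bool" where
  "finite_time_stable G x \<longleftrightarrow> (\<exists>r>0. finite_time_stable_in G x (ball x r))"

definition globally_finite_time_stable ::
    "('a::real_normed_vector \<Rightarrow> 'a) \<Rightarrow> 'a \<Rightarrow> bool" where
  "globally_finite_time_stable G x \<longleftrightarrow> finite_time_stable_in G x UNIV"

end

theory Submission
  imports Defs
begin

text \<open>Write \<open>r\<close> for the residual and \<open>\<delta>\<close> for \<open>sqrt (L\<^sup>2 + \<alpha>\<^sup>2 - 2 * \<alpha> * \<beta>) + \<mu>\<close>. The projection part
  of \<open>r\<close> is \<open>\<delta>\<close>-Lipschitz: \<open>u \<mapsto> f u - \<alpha> u\<close> contributes the square root, the projection onto a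
  fixed set contributes nothing, and moving the set contributes \<open>\<mu>\<close>. Since \<open>f\<close> is \<open>\<beta>\<close>-strongly
  monotone, \<open>\<delta> < \<beta>\<close> makes \<open>r\<close> strongly monotone with constant \<open>c = \<beta> - \<delta>\<close>, besides being
  Lipschitz with some constant \<open>\<Lambda>\<close>. Such a map has exactly one zero \<open>x\<close>, and the zeros of \<open>r\<close> are
  the solutions of the inverse quasi-variational inequality. From here on only these properties
  of \<open>r\<close> matter.

  The field is \<open>- \<sigma> r / \<parallel>r\<parallel> powr \<theta>\<close> with \<open>\<theta> = (\<gamma> - 2) / (\<gamma> - 1)\<close> in \<open>(0, 1)\<close>. Along a solution
  \<open>u\<close>, the bounds \<open>c \<parallel>u - x\<parallel>\<^sup>2 \<le> r u \<bullet> (u - x)\<close> and \<open>\<parallel>r u\<parallel> \<le> \<Lambda> \<parallel>u - x\<parallel>\<close> make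
  \<open>\<parallel>u - x\<parallel> powr \<theta>\<close> decrease at least at the rate \<open>\<sigma> c \<theta> / \<Lambda> powr \<theta>\<close>, so \<open>u\<close> reaches \<open>x\<close>
  within the time given by the initial value of \<open>\<parallel>u - x\<parallel> powr \<theta>\<close> divided by this rate
  (\<open>time_before_zero_le\<close>). This is the asserted bound for \<open>p = 1 - \<theta> / 2\<close>.

  The real work is well-posedness, because the field is only Hoelder continuous at \<open>x\<close>.
  Replacing \<open>\<parallel>r\<parallel>\<close> in the denominator by \<open>max \<parallel>r\<parallel> \<rho>\<close> gives a globally Lipschitz field, whose
  solutions exist for all times by the Picard iteration (\<open>lipschitz_ivp_solution_exists\<close>). Two
  solutions with the same initial value, one for the threshold \<open>\<rho>\<close> and one for a smaller
  threshold (possibly \<open>0\<close>, the original field), coincide as long as \<open>\<parallel>r\<parallel> \<ge> \<rho>\<close>; when this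
  first fails both are within \<open>\<rho> / c\<close> of \<open>x\<close>, and they stay there since all these fields point
  towards \<open>x\<close>. So they differ by at most \<open>2 \<rho> / c\<close> at all times (\<open>truncated_solution_close\<close>).
  Letting \<open>\<rho>\<close> tend to \<open>0\<close>, this one estimate yields both uniqueness and the uniform convergence
  of the truncated solutions to a solution.\<close>

section \<open>Initial value problems with a Lipschitz field\<close>

lemma has_vector_derivative_integral_at_least:
  fixes g :: "real \<Rightarrow> 'a::banach"
  assumes "continuous_on {0..} g" "0 \<le> s"
  shows "((\<lambda>s. integral {0..s} g) has_vector_derivative g s) (at s within {0..})"
proof -
  have "((\<lambda>s. integral {0..s} g) has_vector_derivative g s) (at s within {0..s+1})"
    by (rule integral_has_vector_derivative) (use assms in \<open>auto intro: continuous_on_subset\<close>)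
  moreover have "at s within {0..s+1} = at s within {0..}"
    by (rule at_within_nhd[of _ "{s-1<..<s+1}"]) auto
  ultimately show ?thesis by simp
qed

text \<open>Up to the factor \<open>1 / l\<close>, integration preserves growth of order \<open>exp (l s)\<close>. This is
  what makes the Picard operator a contraction for the norm weighted by \<open>exp (- l s)\<close> on the
  whole half-line at once.\<close>

lemma norm_integral_le_exp_weight:
  fixes g :: "real \<Rightarrow> 'a::banach"
  assumes "continuous_on {0..} g" and l: "l > 0" and "B \<ge> 0" and s: "0 \<le> s"
    and b: "\<And>\<tau>. 0 \<le> \<tau> \<Longrightarrow> norm (g \<tau>) \<le> B * exp (l * \<tau>)"
  shows "norm (integral {0..s} g) \<le> B / l * exp (l * s)"
proof -
  have "((\<lambda>\<tau>. B * exp (l * \<tau>)) has_integral (B / l * exp (l * s) - B / l * exp (l * 0))) {0..s}"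
    using s l
    by (intro fundamental_theorem_of_calculus)
      (auto intro!: derivative_eq_intros simp: has_real_derivative_iff_has_vector_derivative[symmetric])
  moreover have "g integrable_on {0..s}"
    by (rule integrable_continuous_real) (use assms in \<open>auto intro: continuous_on_subset\<close>)
  ultimately have "norm (integral {0..s} g) \<le> B / l * exp (l * s) - B / l * exp (l * 0)"
    using integral_norm_bound_integral[of g "{0..s}" "\<lambda>\<tau>. B * exp (l * \<tau>)"] b
    by (metis atLeastAtMost_iff has_integral_integrable integral_unique)
  then show ?thesis using divide_nonneg_pos[OF \<open>B \<ge> 0\<close> l] by simp
qed

text \<open>The unknown is \<open>y t = exp (- l t) u t\<close>, which ranges over the complete space of bounded
  continuous functions. In terms of \<open>y\<close> the Picard operator contracts by \<open>C / l\<close>, so any \<open>l > C\<close>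
  gives a solution for all times without continuation of local solutions.\<close>

proposition lipschitz_ivp_solution_exists:
  fixes F :: "'a::banach \<Rightarrow> 'a"
  assumes F: "C-lipschitz_on UNIV F"
  shows "\<exists>u. ivp_solution_on {0..} F u0 u"
proof -
  define l where "l = 2 * C + 1"
  have C0: "C \<ge> 0" using F by (rule lipschitz_on_nonneg)
  then have l: "l > 0" by (simp add: l_def)
  have contF: "continuous_on S F" for S
    using lipschitz_on_continuous_on[OF F] continuous_on_subset by blast
  have lipF: "norm (F x - F y) \<le> C * norm (x - y)" for x y
    using lipschitz_onD[OF F, of x y] by (simp add: dist_norm)
  define I where "I y s = u0 + integral {0..s} (\<lambda>\<tau>. F (exp (l * \<tau>) *\<^sub>R apply_bcontfun y \<tau>))"
    for y :: "real \<Rightarrow>\<^sub>C 'a" and s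
  have cont: "continuous_on S (\<lambda>\<tau>. F (exp (l * \<tau>) *\<^sub>R apply_bcontfun y \<tau>))"
    for S and y :: "real \<Rightarrow>\<^sub>C 'a"
    by (rule continuous_on_compose2[OF contF[of UNIV]]) (auto intro!: continuous_intros)
  have derI: "(I y has_vector_derivative F (exp (l * s) *\<^sub>R apply_bcontfun y s)) (at s within {0..})"
    if "0 \<le> s" for y s
    unfolding I_def
    using has_vector_derivative_add[OF has_vector_derivative_const
        has_vector_derivative_integral_at_least[OF cont[of "{0..}" y] that], of u0] by simp
  then have contI: "continuous_on {0..} (I y)" for y
    unfolding continuous_on_eq_continuous_within
    by (blast intro: has_vector_derivative_continuous atLeast_iff[THEN iffD1])
  \<comment> \<open>Bounded continuous functions live on the whole line, so the operator is frozen at negative times.\<close>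
  define A where "A y t = exp (- l * max 0 t) *\<^sub>R I y (max 0 t)" for y t
  have contA: "continuous_on UNIV (A y)" for y
    unfolding A_def by (intro continuous_intros continuous_on_compose2[OF contI]) auto
  have bdI: "norm (I y s) \<le> (norm u0 + (norm (F 0) + C * norm y) / l) * exp (l * s)"
    if "0 \<le> s" for y s
  proof -
    have "norm (F (exp (l * \<tau>) *\<^sub>R apply_bcontfun y \<tau>)) \<le> (norm (F 0) + C * norm y) * exp (l * \<tau>)"
      if "0 \<le> \<tau>" for \<tau>
    proof -
      have "norm (F (exp (l * \<tau>) *\<^sub>R apply_bcontfun y \<tau>))
          \<le> norm (F 0) + C * norm (exp (l * \<tau>) *\<^sub>R apply_bcontfun y \<tau>)"
        using lipF[of "exp (l * \<tau>) *\<^sub>R apply_bcontfun y \<tau>" 0]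
          norm_triangle_ineq2[of "F (exp (l * \<tau>) *\<^sub>R apply_bcontfun y \<tau>)" "F 0"] by simp
      also have "\<dots> \<le> norm (F 0) * exp (l * \<tau>) + C * (norm y * exp (l * \<tau>))"
        using that l C0 norm_bounded[of y \<tau>]
        by (intro add_mono mult_left_mono mult_right_mono) (auto simp: mult_le_cancel_left1)
      finally show ?thesis by (simp add: algebra_simps)
    qed
    then have "norm (I y s) \<le> norm u0 + (norm (F 0) + C * norm y) / l * exp (l * s)"
      unfolding I_def using l C0 that
      by (intro norm_triangle_mono norm_integral_le_exp_weight cont) auto
    moreover have "norm u0 \<le> norm u0 * exp (l * s)"
      using that l by (auto simp: mult_le_cancel_left1)
    ultimately show ?thesis by (simp add: algebra_simps)
  qed
  have "A y \<in> bcontfun" for y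
  proof (rule bcontfun_normI[OF contA])
    fix t
    show "norm (A y t) \<le> norm u0 + (norm (F 0) + C * norm y) / l"
      using bdI[of "max 0 t" y] by (simp add: A_def exp_minus field_simps)
  qed
  then have BA: "apply_bcontfun (Bcontfun (A y)) = A y" for y
    by (rule Bcontfun_inverse)
  have "\<exists>!y. Bcontfun (A y) = y"
  proof (rule banach_fix_type[of "C / l"]; (intro allI)?)
    show "0 \<le> C / l" "C / l < 1" using C0 l by (auto simp: l_def)
    fix y z :: "real \<Rightarrow>\<^sub>C 'a"
    show "dist (Bcontfun (A y)) (Bcontfun (A z)) \<le> C / l * dist y z"
    proof (rule dist_bound, unfold BA)
      fix t :: real
      define s where "s = max 0 t"
      have s: "0 \<le> s" unfolding s_def by (rule max.cobounded1)
      have "norm (integral {0..s} (\<lambda>\<tau>. F (exp (l * \<tau>) *\<^sub>R apply_bcontfun y \<tau>)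
            - F (exp (l * \<tau>) *\<^sub>R apply_bcontfun z \<tau>))) \<le> C * dist y z / l * exp (l * s)"
      proof (rule norm_integral_le_exp_weight)
        fix \<tau> :: real
        have "norm (F (exp (l * \<tau>) *\<^sub>R apply_bcontfun y \<tau>) - F (exp (l * \<tau>) *\<^sub>R apply_bcontfun z \<tau>))
            \<le> C * (exp (l * \<tau>) * dist (apply_bcontfun y \<tau>) (apply_bcontfun z \<tau>))"
          using lipF[of "exp (l * \<tau>) *\<^sub>R apply_bcontfun y \<tau>" "exp (l * \<tau>) *\<^sub>R apply_bcontfun z \<tau>"]
          by (simp add: scaleR_diff_right[symmetric] dist_norm)
        also have "\<dots> \<le> C * (exp (l * \<tau>) * dist y z)"
          using C0 by (intro mult_left_mono dist_bounded) auto
        finally show "norm (F (exp (l * \<tau>) *\<^sub>R apply_bcontfun y \<tau>)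
            - F (exp (l * \<tau>) *\<^sub>R apply_bcontfun z \<tau>)) \<le> C * dist y z * exp (l * \<tau>)"
          by (simp add: mult_ac)
      qed (use l C0 s in \<open>auto intro!: continuous_on_diff cont\<close>)
      also have "integral {0..s} (\<lambda>\<tau>. F (exp (l * \<tau>) *\<^sub>R apply_bcontfun y \<tau>)
            - F (exp (l * \<tau>) *\<^sub>R apply_bcontfun z \<tau>)) = I y s - I z s"
        unfolding I_def using Henstock_Kurzweil_Integration.integral_diff[OF
            integrable_continuous_real[OF cont] integrable_continuous_real[OF cont]] by auto
      finally have "norm (I y s - I z s) \<le> C * dist y z / l * exp (l * s)" .
      then have "exp (- (l * s)) * norm (I y s - I z s)
          \<le> exp (- (l * s)) * (C * dist y z / l * exp (l * s))"
        by (intro mult_left_mono) auto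
      also have "\<dots> = C / l * dist y z"
        by (simp add: exp_minus)
      also have "exp (- (l * s)) * norm (I y s - I z s) = dist (A y t) (A z t)"
        by (simp add: A_def dist_norm s_def flip: scaleR_diff_right)
      finally show "dist (A y t) (A z t) \<le> C / l * dist y z" .
    qed
  qed
  then obtain y where y: "A y = apply_bcontfun y" using BA by metis
  have I_eq: "I y t = exp (l * t) *\<^sub>R apply_bcontfun y t" if "0 \<le> t" for t
    using that by (simp add: y[symmetric] A_def exp_minus)
  have "ivp_solution_on {0..} F u0 (I y)"
    unfolding ivp_solution_on_def
  proof (intro conjI ballI)
    show "I y 0 = u0" by (simp add: I_def)
    show "(I y has_vector_derivative F (I y t)) (at t within {0..})" if "t \<in> {0..}" for t
      using derI[of t y] that by (simp add: I_eq)
  qed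
  then show ?thesis by blast
qed

section \<open>The distance between two curves\<close>

text \<open>The one-sided bound on \<open>u' - v'\<close> makes \<open>exp (- 2 C t) \<parallel>u t - v t\<parallel>\<^sup>2\<close> nonincreasing. The
  derivatives are arbitrary functions of time, so \<open>u\<close> and \<open>v\<close> may follow different fields, or one
  of them may be a constant.\<close>

lemma gronwall_norm_diff:
  fixes u v :: "real \<Rightarrow> 'a::real_inner"
  assumes ab: "a \<le> b"
    and cu: "continuous_on {a..b} u" and cv: "continuous_on {a..b} v"
    and du: "\<And>t. a < t \<Longrightarrow> t < b \<Longrightarrow> (u has_vector_derivative u' t) (at t)"
    and dv: "\<And>t. a < t \<Longrightarrow> t < b \<Longrightarrow> (v has_vector_derivative v' t) (at t)"
    and le: "\<And>t. a < t \<Longrightarrow> t < b \<Longrightarrow> (u' t - v' t) \<bullet> (u t - v t) \<le> C * (norm (u t - v t))\<^sup>2"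
  shows "norm (u b - v b) \<le> exp (C * (b - a)) * norm (u a - v a)"
proof -
  define w where "w t = u t - v t" for t
  define E where "E t = exp (- 2 * C * t) * (w t \<bullet> w t)" for t
  have "E b \<le> E a"
  proof (rule DERIV_nonpos_imp_decreasing_open[OF ab])
    fix t assume t: "a < t" "t < b"
    have dw: "(w has_vector_derivative (u' t - v' t)) (at t)"
      unfolding w_def by (intro has_vector_derivative_diff du dv t)
    have "((\<lambda>t. w t \<bullet> w t) has_real_derivative (2 * ((u' t - v' t) \<bullet> w t))) (at t)"
      using bounded_bilinear.has_vector_derivative[OF bounded_bilinear_inner dw dw]
      by (simp add: has_real_derivative_iff_has_vector_derivative inner_commute)
    then have "(E has_real_derivative
        exp (- 2 * C * t) * (2 * ((u' t - v' t) \<bullet> w t - C * (norm (w t))\<^sup>2))) (at t)"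
      unfolding E_def
      by (auto intro!: derivative_eq_intros simp: power2_norm_eq_inner algebra_simps)
    moreover have "exp (- 2 * C * t) * (2 * ((u' t - v' t) \<bullet> w t - C * (norm (w t))\<^sup>2)) \<le> 0"
      using le[OF t] by (intro mult_nonneg_nonpos) (auto simp: w_def)
    ultimately show "\<exists>y. (E has_real_derivative y) (at t) \<and> y \<le> 0" by blast
  next
    show "continuous_on {a..b} E"
      unfolding E_def w_def by (intro continuous_intros cu cv)
  qed
  then have "w b \<bullet> w b \<le> exp (2 * C * (b - a)) * (w a \<bullet> w a)"
    by (simp add: E_def exp_minus exp_diff right_diff_distrib field_simps)
  also have "\<dots> = (exp (C * (b - a)) * norm (w a))\<^sup>2"
    by (simp add: power_mult_distrib power2_norm_eq_inner flip: exp_of_nat_mult)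
  finally have "(norm (w b))\<^sup>2 \<le> (exp (C * (b - a)) * norm (w a))\<^sup>2"
    by (simp add: power2_norm_eq_inner)
  then show ?thesis
    unfolding w_def by (rule power2_le_imp_le) simp
qed

section \<open>Dividing a vector by a power of its norm\<close>

text \<open>The threshold \<open>\<rho>\<close> keeps the denominator away from \<open>0\<close>; for \<open>\<rho> = 0\<close> this is
  \<open>z / \<parallel>z\<parallel> powr \<theta>\<close>, extended by \<open>0\<close> at \<open>z = 0\<close>.\<close>

definition damped :: "real \<Rightarrow> real \<Rightarrow> 'a::real_normed_vector \<Rightarrow> 'a" where
  "damped \<theta> \<rho> z = z /\<^sub>R (max (norm z) \<rho> powr \<theta>)"

text \<open>With \<open>t = b / a\<close> in \<open>(0, 1]\<close> the claim reduces to \<open>t (1 - t) \<le> 1 - t\<close>, because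
  \<open>t \<le> t powr \<theta>\<close>. The factor \<open>b\<close>, the smaller of the two numbers, is what keeps the constant
  independent of \<open>a\<close>.\<close>

lemma powr_minus_diff_le:
  fixes a b \<theta> :: real
  assumes "0 < b" "b \<le> a" "0 < \<theta>" "\<theta> < 1"
  shows "b * (b powr - \<theta> - a powr - \<theta>) \<le> b powr - \<theta> * (a - b)"
proof -
  define x where "x = b / a"
  have x: "0 < x" "x \<le> 1" using assms by (auto simp: x_def)
  have "x \<le> x powr \<theta>" using powr_mono'[of \<theta> 1 x] assms x by simp
  moreover have "x powr \<theta> = a powr - \<theta> / b powr - \<theta>"
    using assms by (simp add: x_def powr_divide powr_minus field_simps)
  ultimately have "a powr - \<theta> \<ge> x * b powr - \<theta>"
    using assms by (simp add: field_simps)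
  then have "b * (b powr - \<theta> - a powr - \<theta>) \<le> b * (b powr - \<theta> - x * b powr - \<theta>)"
    using assms by (intro mult_left_mono) auto
  also have "\<dots> = b powr - \<theta> * (x * (a - b))"
    using assms by (simp add: x_def field_simps)
  also have "\<dots> \<le> b powr - \<theta> * (1 * (a - b))"
    using assms x by (intro mult_left_mono mult_right_mono) auto
  finally show ?thesis by simp
qed

text \<open>Splitting \<open>z / a powr \<theta> - w / b powr \<theta>\<close> so that the difference of the two weights multiplies
  the vector \<open>w\<close> with the smaller truncated norm \<open>b\<close> allows \<open>powr_minus_diff_le\<close> to be used. The
  case distinction by size is removed afterwards by symmetry.\<close>

lemma damped_lipschitz_aux:
  fixes z w :: "'a::real_normed_vector"
  assumes \<rho>: "0 < \<rho>" and \<theta>: "0 < \<theta>" "\<theta> < 1"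
    and ba: "max (norm w) \<rho> \<le> max (norm z) \<rho>"
  shows "norm (damped \<theta> \<rho> z - damped \<theta> \<rho> w) \<le> 2 * \<rho> powr - \<theta> * norm (z - w)"
proof -
  define a b where "a = max (norm z) \<rho>" and "b = max (norm w) \<rho>"
  have ab: "0 < b" "b \<le> a" "\<rho> \<le> b" "\<rho> \<le> a" "norm w \<le> b"
    using ba \<rho> by (auto simp: a_def b_def)
  have ab_diff: "a - b \<le> norm (z - w)"
    using norm_triangle_ineq2[of z w] norm_ge_zero[of "z - w"]
    unfolding a_def b_def by linarith
  have mono: "y powr - \<theta> \<le> \<rho> powr - \<theta>" if "\<rho> \<le> y" for y
    using powr_mono2'[of "- \<theta>" \<rho> y] that \<rho> \<theta> by simp
  have "damped \<theta> \<rho> z - damped \<theta> \<rho> w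
      = a powr - \<theta> *\<^sub>R (z - w) - (b powr - \<theta> - a powr - \<theta>) *\<^sub>R w"
    by (simp add: damped_def a_def b_def powr_minus algebra_simps)
  also have "norm \<dots> \<le> a powr - \<theta> * norm (z - w) + (b powr - \<theta> - a powr - \<theta>) * norm w"
    using norm_triangle_ineq4[of "a powr - \<theta> *\<^sub>R (z - w)" "(b powr - \<theta> - a powr - \<theta>) *\<^sub>R w"]
      powr_mono2'[of "- \<theta>" b a] ab \<theta> by simp
  also have "\<dots> \<le> \<rho> powr - \<theta> * norm (z - w) + \<rho> powr - \<theta> * norm (z - w)"
  proof (intro add_mono mult_right_mono mono)
    have "(b powr - \<theta> - a powr - \<theta>) * norm w \<le> b * (b powr - \<theta> - a powr - \<theta>)"
      using ab \<theta> powr_mono2'[of "- \<theta>" b a]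
      by (subst mult.commute) (intro mult_right_mono, auto)
    also have "\<dots> \<le> b powr - \<theta> * (a - b)"
      using ab \<theta> by (intro powr_minus_diff_le)
    also have "\<dots> \<le> \<rho> powr - \<theta> * norm (z - w)"
      using ab ab_diff by (intro mult_mono mono) auto
    finally show "(b powr - \<theta> - a powr - \<theta>) * norm w \<le> \<rho> powr - \<theta> * norm (z - w)" .
  qed (use ab in auto)
  finally show ?thesis by (simp add: mult_ac)
qed

lemma damped_lipschitz:
  fixes z w :: "'a::real_normed_vector"
  assumes "0 < \<rho>" "0 < \<theta>" "\<theta> < 1"
  shows "norm (damped \<theta> \<rho> z - damped \<theta> \<rho> w) \<le> 2 * \<rho> powr - \<theta> * norm (z - w)"
  using damped_lipschitz_aux[OF assms, of w z] damped_lipschitz_aux[OF assms, of z w]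
    linear[of "max (norm w) \<rho>" "max (norm z) \<rho>"]
  by (metis norm_minus_commute)

lemma damped_eq_smaller_threshold: "\<rho> \<le> norm z \<Longrightarrow> \<rho>' \<le> \<rho> \<Longrightarrow> damped \<theta> \<rho> z = damped \<theta> \<rho>' z"
  by (simp add: damped_def max_absorb1)

lemma norm_damped_0: "norm (damped \<theta> 0 z) = norm z powr (1 - \<theta>)"
  by (cases "z = 0") (simp_all add: damped_def powr_diff divide_inverse)

lemma damped_truncation_error:
  fixes z :: "'a::real_normed_vector"
  assumes \<rho>: "0 < \<rho>" and \<theta>: "0 < \<theta>" "\<theta> < 1"
  shows "norm (damped \<theta> \<rho> z - damped \<theta> 0 z) \<le> 2 * \<rho> powr (1 - \<theta>)"
proof (cases "\<rho> \<le> norm z")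
  case True
  then show ?thesis using damped_eq_smaller_threshold[of \<rho> z 0 \<theta>] \<rho> by simp
next
  case False
  have "norm (damped \<theta> \<rho> z) = norm z / \<rho> powr \<theta>"
    using False by (simp add: damped_def max_def divide_inverse)
  also have "\<dots> \<le> \<rho> / \<rho> powr \<theta>"
    using False \<rho> by (intro divide_right_mono) auto
  also have "\<dots> = \<rho> powr (1 - \<theta>)" using \<rho> by (simp add: powr_diff)
  finally have "norm (damped \<theta> \<rho> z) \<le> \<rho> powr (1 - \<theta>)" .
  moreover have "norm (damped \<theta> 0 z) \<le> \<rho> powr (1 - \<theta>)"
    unfolding norm_damped_0 using False \<theta> by (intro powr_mono2) auto
  ultimately show ?thesis
    using norm_triangle_ineq4[of "damped \<theta> \<rho> z" "damped \<theta> 0 z"] by simp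
qed

text \<open>Truncating at \<open>\<rho> = \<parallel>z - w\<parallel>\<close> balances the Lipschitz bound of the truncated map against the
  truncation error: both are of order \<open>\<rho> powr (1 - \<theta>)\<close>.\<close>

lemma damped_0_hoelder:
  fixes z w :: "'a::real_normed_vector"
  assumes \<theta>: "0 < \<theta>" "\<theta> < 1"
  shows "norm (damped \<theta> 0 z - damped \<theta> 0 w) \<le> 6 * norm (z - w) powr (1 - \<theta>)"
proof (cases "z = w")
  case False
  define \<rho> where "\<rho> = norm (z - w)"
  have \<rho>: "0 < \<rho>" using False by (simp add: \<rho>_def)
  have "norm (damped \<theta> 0 z - damped \<theta> 0 w)
      \<le> norm (damped \<theta> \<rho> z - damped \<theta> \<rho> w) + norm (damped \<theta> \<rho> z - damped \<theta> 0 z)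
        + norm (damped \<theta> \<rho> w - damped \<theta> 0 w)"
    by norm
  also have "\<dots> \<le> 2 * \<rho> powr - \<theta> * \<rho> + 2 * \<rho> powr (1 - \<theta>) + 2 * \<rho> powr (1 - \<theta>)"
    using damped_lipschitz[OF \<rho> \<theta>] damped_truncation_error[OF \<rho> \<theta>]
    by (intro add_mono) (auto simp: \<rho>_def)
  also have "\<dots> = 6 * \<rho> powr (1 - \<theta>)"
    using \<rho> by (simp add: powr_diff powr_minus divide_inverse)
  finally show ?thesis by (simp add: \<rho>_def)
qed simp

section \<open>Existence and uniqueness for the normalised flow of a strongly monotone map\<close>

lemma ivp_solution_onD:
  assumes "ivp_solution_on I G u0 u" "{a..b} \<subseteq> I"
  shows "continuous_on {a..b} u"
    and "\<And>t. a < t \<Longrightarrow> t < b \<Longrightarrow> (u has_vector_derivative G (u t)) (at t)"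
proof -
  have der: "(u has_vector_derivative G (u t)) (at t within {a..b})" if "t \<in> {a..b}" for t
    using assms that unfolding ivp_solution_on_def
    by (meson has_vector_derivative_within_subset subsetD)
  then show "continuous_on {a..b} u"
    unfolding continuous_on_eq_continuous_within by (blast intro: has_vector_derivative_continuous)
  show "(u has_vector_derivative G (u t)) (at t)" if "a < t" "t < b" for t
    using der[of t] that by (simp add: at_within_Icc_at)
qed

text \<open>The map \<open>r\<close> stands for the residual, with modulus of strong monotonicity \<open>c\<close> and Lipschitz
  constant \<open>\<Lambda>\<close>; the speed \<open>\<sigma>\<close> and the exponent \<open>\<theta>\<close> are the parameters of the flow below.\<close>

locale strongly_monotone_zero =
  fixes r :: "'a::{real_inner, banach} \<Rightarrow> 'a" and x :: 'a and c \<Lambda> \<sigma> \<theta> :: real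
  assumes c: "0 < c" and \<Lambda>: "0 < \<Lambda>" and \<sigma>: "0 < \<sigma>" and \<theta>: "0 < \<theta>" "\<theta> < 1"
    and mono: "c * (norm (u - v))\<^sup>2 \<le> (r u - r v) \<bullet> (u - v)"
    and lip: "norm (r u - r v) \<le> \<Lambda> * norm (u - v)"
    and zero: "r x = 0"
begin

text \<open>The field of interest is \<open>flow_field 0\<close>; positive \<open>\<rho>\<close> gives its Lipschitz truncations.\<close>

definition flow_field :: "real \<Rightarrow> 'a \<Rightarrow> 'a" where
  "flow_field \<rho> u = - (\<sigma> *\<^sub>R damped \<theta> \<rho> (r u))"

lemma inner_r_ge: "c * (norm (u - x))\<^sup>2 \<le> r u \<bullet> (u - x)"
  using mono[of u x] zero by simp

lemma norm_r_ge: "c * norm (u - x) \<le> norm (r u)"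
proof (cases "u = x")
  case False
  have "(c * norm (u - x)) * norm (u - x) \<le> norm (r u) * norm (u - x)"
    using inner_r_ge[of u] norm_cauchy_schwarz[of "r u" "u - x"]
    by (simp add: power2_eq_square mult.assoc)
  with False show ?thesis by simp
qed simp

lemma norm_r_le: "norm (r u) \<le> \<Lambda> * norm (u - x)"
  using lip[of u x] zero by simp

lemma r_eq_0_iff: "r u = 0 \<longleftrightarrow> u = x"
  using norm_r_ge[of u] zero c by (auto simp: mult_le_0_iff)

lemma flow_field_zero: "flow_field \<rho> x = 0"
  by (simp add: flow_field_def damped_def zero)

lemma flow_field_dissipative: "flow_field \<rho> u \<bullet> (u - x) \<le> 0"
proof -
  have "0 \<le> r u \<bullet> (u - x)"
    using inner_r_ge[of u] c by (meson order_trans mult_nonneg_nonneg less_imp_le zero_le_power2)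
  then show ?thesis
    using \<sigma> by (simp add: flow_field_def damped_def)
qed

lemma flow_field_lipschitz:
  assumes "0 < \<rho>"
  shows "norm (flow_field \<rho> u - flow_field \<rho> v) \<le> 2 * \<sigma> * \<Lambda> * \<rho> powr - \<theta> * norm (u - v)"
proof -
  have "norm (flow_field \<rho> u - flow_field \<rho> v)
      = \<sigma> * norm (damped \<theta> \<rho> (r u) - damped \<theta> \<rho> (r v))"
    using \<sigma> by (simp add: flow_field_def norm_minus_commute flip: scaleR_diff_right)
  also have "\<dots> \<le> \<sigma> * (2 * \<rho> powr - \<theta> * (\<Lambda> * norm (u - v)))"
    using \<sigma> lip[of u v]
    by (intro mult_left_mono order_trans[OF damped_lipschitz[OF assms \<theta>]]) auto
  finally show ?thesis by (simp add: mult_ac)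
qed

lemma flow_field_0_hoelder:
  "norm (flow_field 0 u - flow_field 0 v) \<le> 6 * \<sigma> * (\<Lambda> * norm (u - v)) powr (1 - \<theta>)"
proof -
  have "norm (flow_field 0 u - flow_field 0 v)
      = \<sigma> * norm (damped \<theta> 0 (r u) - damped \<theta> 0 (r v))"
    using \<sigma> by (simp add: flow_field_def norm_minus_commute flip: scaleR_diff_right)
  also have "\<dots> \<le> \<sigma> * (6 * (\<Lambda> * norm (u - v)) powr (1 - \<theta>))"
    using \<sigma> \<theta> lip[of u v]
    by (intro mult_left_mono order_trans[OF damped_0_hoelder[OF \<theta>]] powr_mono2) auto
  finally show ?thesis by (simp add: mult_ac)
qed

lemma flow_field_truncation_error:
  assumes "0 < \<rho>"
  shows "norm (flow_field \<rho> u - flow_field 0 u) \<le> 2 * \<sigma> * \<rho> powr (1 - \<theta>)"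
proof -
  have "norm (flow_field \<rho> u - flow_field 0 u)
      = \<sigma> * norm (damped \<theta> \<rho> (r u) - damped \<theta> 0 (r u))"
    using \<sigma> by (simp add: flow_field_def norm_minus_commute flip: scaleR_diff_right)
  then show ?thesis
    using damped_truncation_error[OF assms \<theta>, of "r u"] \<sigma> by simp
qed

text \<open>Comparison with the constant solution \<open>x\<close>: dissipativity is the one-sided bound of
  \<open>gronwall_norm_diff\<close> with \<open>C = 0\<close>. In particular a solution that reaches \<open>x\<close> stays there.\<close>

lemma dist_zero_antimono:
  assumes v: "ivp_solution_on I (flow_field \<rho>) v0 v" and ab: "a \<le> b" "{a..b} \<subseteq> I"
  shows "norm (v b - x) \<le> norm (v a - x)"
proof -
  have "norm (v b - x) \<le> exp (0 * (b - a)) * norm (v a - x)"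
    by (rule gronwall_norm_diff[where u' = "\<lambda>t. flow_field \<rho> (v t)" and v' = "\<lambda>t. 0"])
      (use ab ivp_solution_onD[OF v ab(2)] flow_field_dissipative in auto)
  then show ?thesis by simp
qed

text \<open>Until \<open>v\<close> first meets the region \<open>\<parallel>r\<parallel> \<le> \<rho>\<close> it does not see the difference between the two
  thresholds, so it solves the Lipschitz equation for \<open>\<rho>\<close> and equals \<open>w\<close>. From then on
  both stay in the ball of radius \<open>\<rho> / c\<close> around \<open>x\<close>.\<close>

lemma truncated_solution_close:
  assumes \<rho>: "0 < \<rho>" "\<rho>' \<le> \<rho>" and t: "0 \<le> t"
    and w: "ivp_solution_on I (flow_field \<rho>) u0 w" and wI: "{0..t} \<subseteq> I"
    and v: "ivp_solution_on J (flow_field \<rho>') u0 v" and vJ: "{0..t} \<subseteq> J"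
  shows "norm (w t - v t) \<le> 2 * \<rho> / c"
proof -
  have start: "w 0 = v 0" using v w by (simp add: ivp_solution_on_def)
  have agree: "w s = v s"
    if s: "0 \<le> s" "s \<le> t" and far: "\<And>q. 0 \<le> q \<Longrightarrow> q < s \<Longrightarrow> \<rho> \<le> norm (r (v q))" for s
  proof -
    have sub: "{0..s} \<subseteq> I" "{0..s} \<subseteq> J" using s wI vJ by auto
    have "norm (w s - v s) \<le> exp (2 * \<sigma> * \<Lambda> * \<rho> powr - \<theta> * (s - 0)) * norm (w 0 - v 0)"
    proof (rule gronwall_norm_diff[where u' = "\<lambda>q. flow_field \<rho> (w q)"
          and v' = "\<lambda>q. flow_field \<rho>' (v q)"])
      fix q assume q: "0 < q" "q < s"
      have "flow_field \<rho>' (v q) = flow_field \<rho> (v q)"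
        unfolding flow_field_def using q \<rho> far[of q] by (subst damped_eq_smaller_threshold) auto
      then have "(flow_field \<rho> (w q) - flow_field \<rho>' (v q)) \<bullet> (w q - v q)
          \<le> norm (flow_field \<rho> (w q) - flow_field \<rho> (v q)) * norm (w q - v q)"
        by (simp add: norm_cauchy_schwarz)
      also have "\<dots> \<le> 2 * \<sigma> * \<Lambda> * \<rho> powr - \<theta> * norm (w q - v q) * norm (w q - v q)"
        by (intro mult_right_mono flow_field_lipschitz \<rho>) auto
      finally show "(flow_field \<rho> (w q) - flow_field \<rho>' (v q)) \<bullet> (w q - v q)
          \<le> 2 * \<sigma> * \<Lambda> * \<rho> powr - \<theta> * (norm (w q - v q))\<^sup>2"
        by (simp add: power2_eq_square mult.assoc)
    qed (use s ivp_solution_onD[OF w sub(1)] ivp_solution_onD[OF v sub(2)] in auto)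
    then show ?thesis by (simp add: start)
  qed
  show ?thesis
  proof (cases "\<exists>s\<in>{0..t}. norm (r (v s)) \<le> \<rho>")
    case False
    then have "w t = v t" using t by (intro agree) (auto simp: not_le less_imp_le)
    then show ?thesis using \<rho> c by simp
  next
    case True
    \<comment> \<open>The least element of this compact set is the first time at which the thresholds can differ.\<close>
    define S where "S = {s \<in> {0..t}. norm (r (v s)) \<le> \<rho>}"
    have "continuous_on UNIV r"
      using \<Lambda> by (intro lipschitz_on_continuous_on[of \<Lambda>] lipschitz_onI)
        (auto simp: dist_norm lip)
    then have "continuous_on {0..t} (\<lambda>s. r (v s))"
      by (rule continuous_on_compose2[OF _ ivp_solution_onD(1)[OF v vJ]]) auto
    then have "continuous_on {0..t} (\<lambda>s. norm (r (v s)))"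
      by (rule continuous_on_norm)
    then have "closed ({0..t} \<inter> (\<lambda>s. norm (r (v s))) -` {..\<rho>})"
      by (intro continuous_closed_preimage) auto
    also have "{0..t} \<inter> (\<lambda>s. norm (r (v s))) -` {..\<rho>} = S"
      by (auto simp: S_def)
    finally have "compact S"
      unfolding compact_eq_bounded_closed by (auto simp: S_def intro: bounded_subset[of "{0..t}"])
    moreover have "S \<noteq> {}" using True by (auto simp: S_def)
    ultimately obtain s where s: "s \<in> S" and least: "\<And>q. q \<in> S \<Longrightarrow> s \<le> q"
      using compact_attains_inf by metis
    have "w s = v s"
    proof (rule agree)
      fix q assume "0 \<le> q" "q < s"
      then show "\<rho> \<le> norm (r (v q))"
        using least[of q] s by (fastforce simp: S_def)
    qed (use s in \<open>auto simp: S_def\<close>)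
    have "norm (w t - v t) \<le> norm (w t - x) + norm (v t - x)" by norm
    also have "\<dots> \<le> norm (w s - x) + norm (v s - x)"
      using s wI vJ
      by (intro add_mono dist_zero_antimono[OF w] dist_zero_antimono[OF v]) (auto simp: S_def)
    also have "\<dots> = 2 * norm (v s - x)" by (simp add: \<open>w s = v s\<close>)
    also have "\<dots> \<le> 2 * (\<rho> / c)"
      using order_trans[OF norm_r_ge[of "v s"], of \<rho>] s c
      by (simp add: S_def field_simps)
    finally show ?thesis by simp
  qed
qed

lemma truncated_solution_exists:
  assumes "0 < \<rho>"
  shows "\<exists>u. ivp_solution_on {0..} (flow_field \<rho>) u0 u"
proof (rule lipschitz_ivp_solution_exists)
  show "(2 * \<sigma> * \<Lambda> * \<rho> powr - \<theta>)-lipschitz_on UNIV (flow_field \<rho>)"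
    using \<sigma> \<Lambda> flow_field_lipschitz[OF assms] by (intro lipschitz_onI) (auto simp: dist_norm)
qed

text \<open>Both solutions are within \<open>2 \<rho> / c\<close> of one solution of the truncated equation, for every
  \<open>\<rho> > 0\<close>.\<close>

lemma flow_solution_unique:
  assumes u: "ivp_solution_on {0..} (flow_field 0) u0 u"
    and v: "ivp_solution_on {0..<\<tau>} (flow_field 0) u0 v" and t: "t \<in> {0..<\<tau>}"
  shows "v t = u t"
proof -
  have "norm (v t - u t) \<le> 0 + e" if e: "0 < e" for e
  proof -
    define \<rho> where "\<rho> = c * e / 4"
    have \<rho>: "0 < \<rho>" using e c by (simp add: \<rho>_def)
    obtain w where w: "ivp_solution_on {0..} (flow_field \<rho>) u0 w"
      using truncated_solution_exists[OF \<rho>] by blast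
    have "norm (w t - u t) \<le> 2 * \<rho> / c" "norm (w t - v t) \<le> 2 * \<rho> / c"
      using \<rho> t by (intro truncated_solution_close[OF _ _ _ w _ u]
          truncated_solution_close[OF _ _ _ w _ v]; force)+
    moreover have "2 * \<rho> / c = e / 2" using c by (simp add: \<rho>_def)
    ultimately show ?thesis
      using norm_triangle_ineq4[of "w t - u t" "w t - v t"] by simp
  qed
  then have "norm (v t - u t) \<le> 0" by (rule field_le_epsilon)
  then show ?thesis by simp
qed

text \<open>The truncated solutions for \<open>\<rho> = 1 / (n + 1)\<close> converge uniformly on the half-line by
  \<open>truncated_solution_close\<close>. By the truncation error and the Hoelder bound their derivatives
  converge uniformly too, so the limit may be differentiated termwise.\<close>

lemma flow_solution_exists: "\<exists>u. ivp_solution_on {0..} (flow_field 0) u0 u"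
proof -
  define \<rho> where "\<rho> n = inverse (real (Suc n))" for n
  have \<rho>: "0 < \<rho> n" for n by (simp add: \<rho>_def)
  have \<rho>_lim: "\<rho> \<longlonglongrightarrow> 0" unfolding \<rho>_def by (rule LIMSEQ_inverse_real_of_nat)
  have \<rho>_anti: "\<rho> m \<le> \<rho> n" if "n \<le> m" for m n
    using that by (simp add: \<rho>_def field_simps)
  have "\<forall>n. \<exists>w. ivp_solution_on {0..} (flow_field (\<rho> n)) u0 w"
    using truncated_solution_exists[OF \<rho>] by blast
  then obtain w where w: "\<And>n. ivp_solution_on {0..} (flow_field (\<rho> n)) u0 (w n)" by metis
  have close: "norm (w n t - w m t) \<le> 2 * \<rho> n / c" if "n \<le> m" "0 \<le> t" for n m t
    using truncated_solution_close[OF \<rho> \<rho>_anti[OF that(1)] that(2) w _ w] by auto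
  have small: "eventually (\<lambda>n. 2 * \<rho> n / c < e) sequentially" if "0 < e" for e
  proof -
    have "(\<lambda>n. 2 * \<rho> n / c) \<longlonglongrightarrow> 2 * 0 / c" by (intro tendsto_intros \<rho>_lim) (use c in auto)
    then show ?thesis using that by (intro order_tendstoD(2)) auto
  qed
  have "convergent (\<lambda>n. w n t)" if t: "0 \<le> t" for t
  proof (rule Cauchy_convergent, rule metric_CauchyI)
    fix e :: real assume "0 < e"
    then obtain N where N: "2 * \<rho> N / c < e / 2"
      using small[of "e / 2"] by (auto simp: eventually_sequentially)
    have "dist (w m t) (w n t) < e" if "N \<le> m" "N \<le> n" for m n
    proof -
      have "dist (w m t) (w n t) \<le> dist (w N t) (w m t) + dist (w N t) (w n t)"
        by (rule dist_triangle3)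
      then show ?thesis
        using close[OF that(1) t] close[OF that(2) t] N by (simp add: dist_norm)
    qed
    then show "\<exists>M. \<forall>m\<ge>M. \<forall>n\<ge>M. dist (w m t) (w n t) < e" by blast
  qed
  then have lim: "(\<lambda>n. w n t) \<longlonglongrightarrow> lim (\<lambda>n. w n t)" if "0 \<le> t" for t
    using that convergent_LIMSEQ_iff by blast
  define u where "u t = lim (\<lambda>n. w n t)" for t
  have close_lim: "norm (w n t - u t) \<le> 2 * \<rho> n / c" if "0 \<le> t" for n t
  proof (rule tendsto_upperbound)
    show "(\<lambda>m. norm (w n t - w m t)) \<longlonglongrightarrow> norm (w n t - u t)"
      unfolding u_def by (intro tendsto_intros lim that)
    show "\<forall>\<^sub>F m in sequentially. norm (w n t - w m t) \<le> 2 * \<rho> n / c"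
      using close that by (auto simp: eventually_sequentially)
  qed simp
  \<comment> \<open>Truncation error of the field plus the effect of replacing \<open>w n t\<close> by its limit.\<close>
  define err where "err n = 2 * \<sigma> * \<rho> n powr (1 - \<theta>) + 6 * \<sigma> * (\<Lambda> * (2 * \<rho> n / c)) powr (1 - \<theta>)" for n
  have "err \<longlonglongrightarrow> 2 * \<sigma> * 0 powr (1 - \<theta>) + 6 * \<sigma> * (\<Lambda> * (2 * 0 / c)) powr (1 - \<theta>)"
    unfolding err_def
    by (intro tendsto_intros tendsto_powr' \<rho>_lim) (use c \<theta> \<rho> \<Lambda> in \<open>auto simp: less_imp_le\<close>)
  then have err_lim: "err \<longlonglongrightarrow> 0" using \<theta> by simp
  have field_close: "norm (flow_field (\<rho> n) (w n t) - flow_field 0 (u t)) \<le> err n" if "0 \<le> t" for n t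
  proof -
    have "norm (flow_field (\<rho> n) (w n t) - flow_field 0 (u t))
        \<le> norm (flow_field (\<rho> n) (w n t) - flow_field 0 (w n t))
          + norm (flow_field 0 (w n t) - flow_field 0 (u t))"
      by norm
    also have "\<dots> \<le> 2 * \<sigma> * \<rho> n powr (1 - \<theta>) + 6 * \<sigma> * (\<Lambda> * norm (w n t - u t)) powr (1 - \<theta>)"
      by (intro add_mono flow_field_truncation_error flow_field_0_hoelder \<rho>)
    also have "\<dots> \<le> err n"
      unfolding err_def using \<sigma> \<theta> \<Lambda> close_lim[OF that] less_imp_le[OF \<rho>]
      by (intro add_mono mult_left_mono powr_mono2) auto
    finally show ?thesis .
  qed
  have "\<exists>g. \<forall>t\<in>{0..}. (\<lambda>n. w n t) \<longlonglongrightarrow> g t \<and>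
      (g has_derivative (\<lambda>h. h *\<^sub>R flow_field 0 (u t))) (at t within {0..})"
  proof (rule has_derivative_sequence)
    show "convex {0::real..}" by simp
    show "(w n has_derivative (\<lambda>h. h *\<^sub>R flow_field (\<rho> n) (w n t))) (at t within {0..})"
      if "t \<in> {0..}" for n t
      using w[of n] that by (auto simp: ivp_solution_on_def has_vector_derivative_def)
    show "\<forall>\<^sub>F n in sequentially. \<forall>t\<in>{0..}. \<forall>h.
        norm (h *\<^sub>R flow_field (\<rho> n) (w n t) - h *\<^sub>R flow_field 0 (u t)) \<le> e * norm h"
      if "0 < e" for e
      using order_tendstoD(2)[OF err_lim that]
    proof eventually_elim
      case (elim n)
      show ?case
      proof (intro ballI allI)
        fix t h :: real assume "t \<in> {0..}"
        then have "norm (flow_field (\<rho> n) (w n t) - flow_field 0 (u t)) \<le> e"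
          using field_close[of t n] elim by simp
        then have "norm h * norm (flow_field (\<rho> n) (w n t) - flow_field 0 (u t)) \<le> norm h * e"
          by (intro mult_left_mono) auto
        then show "norm (h *\<^sub>R flow_field (\<rho> n) (w n t) - h *\<^sub>R flow_field 0 (u t)) \<le> e * norm h"
          by (simp add: mult.commute[of e] flip: scaleR_diff_right)
      qed
    qed
    show "(0::real) \<in> {0..}" by simp
    show "(\<lambda>n. w n 0) \<longlonglongrightarrow> u0"
      using w by (simp add: ivp_solution_on_def)
  qed
  then obtain g where g: "\<And>t. 0 \<le> t \<Longrightarrow> (\<lambda>n. w n t) \<longlonglongrightarrow> g t"
    and dg: "\<And>t. 0 \<le> t \<Longrightarrow> (g has_vector_derivative flow_field 0 (u t)) (at t within {0..})"
    by (auto simp: has_vector_derivative_def)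
  have gu: "g t = u t" if "0 \<le> t" for t
    using g[OF that] by (simp add: u_def limI)
  have "(\<lambda>n. w n 0) \<longlonglongrightarrow> u0" using w by (simp add: ivp_solution_on_def)
  then have "g 0 = u0" using g[of 0] LIMSEQ_unique by blast
  then have "ivp_solution_on {0..} (flow_field 0) u0 g"
    using dg gu by (simp add: ivp_solution_on_def)
  then show ?thesis by blast
qed

lemma flow_the_solution:
  obtains u where "the_ivp_solution (flow_field 0) u0 u"
  using flow_solution_exists flow_solution_unique unfolding the_ivp_solution_def by blast

section \<open>Arrival in finite time\<close>

lemma flow_field_0_decay:
  assumes "u \<noteq> x"
  shows "flow_field 0 u \<bullet> (u - x) \<le> - (\<sigma> * c / \<Lambda> powr \<theta> * norm (u - x) powr (2 - \<theta>))"
proof -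
  have pos: "0 < norm (u - x)" "0 < norm (r u)"
    using assms by (auto simp: r_eq_0_iff)
  have "c * (norm (u - x))\<^sup>2 / (\<Lambda> * norm (u - x)) powr \<theta> \<le> (r u \<bullet> (u - x)) / norm (r u) powr \<theta>"
  proof (rule frac_le)
    show "0 \<le> r u \<bullet> (u - x)"
      using inner_r_ge[of u] c by (meson order_trans mult_nonneg_nonneg less_imp_le zero_le_power2)
    show "norm (r u) powr \<theta> \<le> (\<Lambda> * norm (u - x)) powr \<theta>"
      using norm_r_le[of u] \<theta> by (intro powr_mono2) auto
  qed (use inner_r_ge pos in auto)
  also have "c * (norm (u - x))\<^sup>2 / (\<Lambda> * norm (u - x)) powr \<theta>
      = c / \<Lambda> powr \<theta> * norm (u - x) powr (2 - \<theta>)"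
    using pos \<Lambda> by (simp add: powr_mult powr_diff)
  finally have "\<sigma> * (c / \<Lambda> powr \<theta> * norm (u - x) powr (2 - \<theta>))
      \<le> \<sigma> * ((r u \<bullet> (u - x)) / norm (r u) powr \<theta>)"
    using \<sigma> by (intro mult_left_mono) auto
  then show ?thesis
    by (simp add: flow_field_def damped_def divide_inverse mult_ac)
qed

text \<open>As long as \<open>u \<noteq> x\<close>, the decay estimate and the chain rule give
  \<open>(\<parallel>u - x\<parallel> powr \<theta>)' \<le> - k\<close> with \<open>k = \<sigma> c \<theta> / \<Lambda> powr \<theta>\<close>: the powers of the distance cancel
  exactly for the exponent \<open>\<theta>\<close>. So \<open>\<parallel>u - x\<parallel> powr \<theta> + k s\<close> is nonincreasing.\<close>

lemma time_before_zero_le: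
  assumes u: "ivp_solution_on {0..} (flow_field 0) u0 u" and t: "0 \<le> t"
    and away: "\<And>s. 0 \<le> s \<Longrightarrow> s < t \<Longrightarrow> u s \<noteq> x"
  shows "t \<le> \<Lambda> powr \<theta> / (\<sigma> * c * \<theta>) * norm (u0 - x) powr \<theta>"
proof -
  define k where "k = \<sigma> * c * \<theta> / \<Lambda> powr \<theta>"
  have k: "0 < k" using \<sigma> c \<theta> \<Lambda> by (simp add: k_def)
  \<comment> \<open>The squared distance is smooth in \<open>u s\<close>, unlike the distance itself; hence the exponent \<open>\<theta> / 2\<close> below.\<close>
  define D where "D s = (u s - x) \<bullet> (u s - x)" for s
  define \<phi> where "\<phi> s = D s powr (\<theta> / 2) + k * s" for s
  have sub: "{0..t} \<subseteq> {0..}" by auto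
  have D_powr: "D s powr q = norm (u s - x) powr (2 * q)" if "u s \<noteq> x" for s q
  proof -
    have "D s = norm (u s - x) powr 2"
      using that by (simp add: D_def dot_square_norm)
    then show ?thesis by (simp only: powr_powr)
  qed
  have "\<phi> t \<le> \<phi> 0"
  proof (rule DERIV_nonpos_imp_decreasing_open[OF t])
    fix s assume s: "0 < s" "s < t"
    let ?n = "norm (u s - x)"
    have ne: "u s \<noteq> x" using away[of s] s by simp
    have du: "((\<lambda>s. u s - x) has_vector_derivative flow_field 0 (u s)) (at s)"
      using ivp_solution_onD(2)[OF u sub s] by (simp add: has_vector_derivative_diff_const)
    have dD: "(D has_real_derivative 2 * (flow_field 0 (u s) \<bullet> (u s - x))) (at s)"
      using bounded_bilinear.has_vector_derivative[OF bounded_bilinear_inner du du]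
      by (simp add: D_def[abs_def] has_real_derivative_iff_has_vector_derivative inner_commute)
    have "((\<lambda>s. D s powr (\<theta> / 2)) has_real_derivative
        \<theta> / 2 * D s powr (\<theta> / 2 - of_nat 1) * (2 * (flow_field 0 (u s) \<bullet> (u s - x)))) (at s)"
      using ne by (intro DERIV_fun_powr dD) (simp add: D_def)
    from DERIV_add[OF this DERIV_cmult_Id[of k]]
    have "(\<phi> has_real_derivative
        \<theta> * ?n powr (\<theta> - 2) * (flow_field 0 (u s) \<bullet> (u s - x)) + k) (at s)"
      using D_powr[OF ne, of "\<theta> / 2 - 1"] by (simp add: \<phi>_def[abs_def] mult_ac)
    moreover have "\<theta> * ?n powr (\<theta> - 2) * (flow_field 0 (u s) \<bullet> (u s - x))
        \<le> \<theta> * ?n powr (\<theta> - 2) * - (\<sigma> * c / \<Lambda> powr \<theta> * ?n powr (2 - \<theta>))"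
      using \<theta> by (intro mult_left_mono flow_field_0_decay ne) auto
    moreover have "\<dots> = - k * (?n powr (\<theta> - 2) * ?n powr (2 - \<theta>))"
      by (simp add: k_def)
    moreover have "?n powr (\<theta> - 2) * ?n powr (2 - \<theta>) = 1"
      using ne by (simp flip: powr_add)
    ultimately show "\<exists>y. (\<phi> has_real_derivative y) (at s) \<and> y \<le> 0" by force
  next
    show "continuous_on {0..t} \<phi>"
      unfolding \<phi>_def D_def using \<theta>
      by (intro continuous_intros continuous_on_powr' ivp_solution_onD(1)[OF u sub]) auto
  qed
  then have "D t powr (\<theta> / 2) + k * t \<le> D 0 powr (\<theta> / 2)"
    by (simp add: \<phi>_def)
  then have "k * t \<le> D 0 powr (\<theta> / 2)"
    using powr_ge_zero[of "D t" "\<theta> / 2"] by linarith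
  also have "\<dots> \<le> norm (u0 - x) powr \<theta>"
    using u D_powr[of 0 "\<theta> / 2"] by (cases "u0 = x") (auto simp: ivp_solution_on_def D_def)
  finally have "t \<le> norm (u0 - x) powr \<theta> / k" using k by (simp add: field_simps)
  then show ?thesis by (simp add: k_def mult.commute)
qed

theorem settling_time_le:
  assumes T: "settling_time_function (flow_field 0) x UNIV T" and "u0 \<noteq> x"
  shows "T u0 \<le> \<Lambda> powr \<theta> / (\<sigma> * c * \<theta>) * norm (u0 - x) powr \<theta>"
proof -
  obtain u where "0 < T u0" "the_ivp_solution (flow_field 0) u0 u" "\<forall>t\<in>{0..<T u0}. u t \<in> UNIV - {x}"
    using assms unfolding settling_time_function_def by blast
  then show ?thesis
    by (intro time_before_zero_le[of u0 u]) (auto simp: the_ivp_solution_def)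
qed

text \<open>The settling time is the first time at which \<open>u\<close> equals \<open>x\<close>; by \<open>time_before_zero_le\<close> it
  has to occur before \<open>b\<close>.\<close>

lemma settling_time_exists:
  assumes u: "ivp_solution_on {0..} (flow_field 0) u0 u" and u0: "u0 \<noteq> x"
  shows "\<exists>T>0. (\<forall>t\<in>{0..<T}. u t \<in> UNIV - {x}) \<and> (u \<longlongrightarrow> x) (at_left T)"
proof -
  define b where "b = \<Lambda> powr \<theta> / (\<sigma> * c * \<theta>) * norm (u0 - x) powr \<theta> + 1"
  define Z where "Z = {t \<in> {0..b}. u t = x}"
  have b: "0 < b" using \<Lambda> \<sigma> c \<theta> by (simp add: b_def add_nonneg_pos)
  have "Z \<noteq> {}"
  proof
    assume "Z = {}"
    then have "b \<le> b - 1"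
      using time_before_zero_le[OF u, of b] b by (auto simp: Z_def b_def)
    then show False by simp
  qed
  moreover have "compact Z"
  proof -
    have "closed Z"
      unfolding Z_def
      using continuous_closed_preimage_constant[OF ivp_solution_onD(1)[OF u, of 0 b], of x] by auto
    then show ?thesis
      unfolding compact_eq_bounded_closed by (auto simp: Z_def intro: bounded_subset[of "{0..b}"])
  qed
  ultimately obtain T where T: "T \<in> Z" and least: "\<And>t. t \<in> Z \<Longrightarrow> T \<le> t"
    using compact_attains_inf by metis
  have "u 0 \<noteq> x" using u u0 by (simp add: ivp_solution_on_def)
  then have "0 < T" using T by (cases "T = 0") (auto simp: Z_def)
  moreover have "\<forall>t\<in>{0..<T}. u t \<in> UNIV - {x}"
    using T least by (fastforce simp: Z_def)
  moreover have "(u \<longlongrightarrow> x) (at_left T)"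
  proof -
    have "continuous_on {0..T} u" by (rule ivp_solution_onD(1)[OF u]) auto
    then have "(u \<longlongrightarrow> u T) (at T within {0..T})"
      using \<open>0 < T\<close> by (simp add: continuous_on_def)
    then show ?thesis
      using T \<open>0 < T\<close> by (simp add: Z_def at_within_Icc_at_left)
  qed
  ultimately show ?thesis by blast
qed

theorem globally_finite_time_stable_flow: "globally_finite_time_stable (flow_field 0) x"
  unfolding globally_finite_time_stable_def finite_time_stable_in_def
proof (intro conjI)
  show "continuous_on UNIV (flow_field 0)"
    unfolding continuous_on_def
  proof
    fix u :: 'a
    have "((\<lambda>v. 6 * \<sigma> * (\<Lambda> * norm (v - u)) powr (1 - \<theta>)) \<longlongrightarrow>
        6 * \<sigma> * (\<Lambda> * norm (u - u)) powr (1 - \<theta>)) (at u)"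
      using \<theta> \<Lambda> by (intro tendsto_intros tendsto_powr') auto
    then have "((\<lambda>v. 6 * \<sigma> * (\<Lambda> * norm (v - u)) powr (1 - \<theta>)) \<longlongrightarrow> 0) (at u)"
      using \<theta> by simp
    then have "((\<lambda>v. flow_field 0 v - flow_field 0 u) \<longlongrightarrow> 0) (at u)"
      by (rule Lim_null_comparison[rotated]) (simp add: flow_field_0_hoelder)
    then show "(flow_field 0 \<longlongrightarrow> flow_field 0 u) (at u)"
      by (simp add: LIM_zero_iff)
  qed
  show "equilibrium_point (flow_field 0) x"
    by (simp add: equilibrium_point_def flow_field_zero)
  show "lyapunov_stable (flow_field 0) x"
    unfolding lyapunov_stable_def
  proof (intro allI impI)
    fix \<epsilon> :: real assume "0 < \<epsilon>"
    have "\<exists>u. the_ivp_solution (flow_field 0) u0 u \<and> (\<forall>t>0. u t \<in> ball x \<epsilon>)"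
      if u0: "u0 \<in> ball x \<epsilon>" for u0
    proof -
      obtain u where u: "the_ivp_solution (flow_field 0) u0 u" by (rule flow_the_solution)
      then have sol: "ivp_solution_on {0..} (flow_field 0) u0 u" by (simp add: the_ivp_solution_def)
      have "norm (u t - x) \<le> norm (u0 - x)" if "0 < t" for t
        using dist_zero_antimono[OF sol, of 0 t] that sol by (simp add: ivp_solution_on_def)
      then have "\<forall>t>0. u t \<in> ball x \<epsilon>"
        using u0 by (fastforce simp: dist_norm norm_minus_commute)
      then show ?thesis using u by blast
    qed
    then show "\<exists>\<delta>>0. \<forall>u0\<in>ball x \<delta>.
        \<exists>u. the_ivp_solution (flow_field 0) u0 u \<and> (\<forall>t>0. u t \<in> ball x \<epsilon>)"
      using \<open>0 < \<epsilon>\<close> by blast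
  qed
  have "\<exists>T. u0 \<noteq> x \<longrightarrow> 0 < T \<and> (\<exists>u. the_ivp_solution (flow_field 0) u0 u \<and>
      (\<forall>t\<in>{0..<T}. u t \<in> UNIV - {x}) \<and> (u \<longlongrightarrow> x) (at_left T))" for u0 :: 'a
    using flow_the_solution[of u0] settling_time_exists[of u0]
    by (metis the_ivp_solution_def)
  then obtain T where "\<forall>u0. u0 \<noteq> x \<longrightarrow> 0 < T u0 \<and> (\<exists>u. the_ivp_solution (flow_field 0) u0 u \<and>
      (\<forall>t\<in>{0..<T u0}. u t \<in> UNIV - {x}) \<and> (u \<longlongrightarrow> x) (at_left (T u0)))"
    by metis
  then have "settling_time_function (flow_field 0) x UNIV T"
    unfolding settling_time_function_def by blast
  then show "\<exists>T. settling_time_function (flow_field 0) x UNIV T" by blast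
qed

end

section \<open>Zeros of strongly monotone Lipschitz maps\<close>

lemma power2_norm_diff_scaleR:
  "(norm (a - s *\<^sub>R b))\<^sup>2 = (norm a)\<^sup>2 - 2 * s * (a \<bullet> b) + s\<^sup>2 * (norm b)\<^sup>2"
  for a b :: "'a::real_inner"
  by (simp only: power2_norm_eq_inner)
    (simp add: inner_diff inner_commute power2_eq_square algebra_simps)

text \<open>Zeros of \<open>r\<close> are fixed points of \<open>u \<mapsto> u - s r u\<close>. Expanding the square shows that this map
  multiplies squared distances by at most \<open>1 - 2 s c + s\<^sup>2 M\<^sup>2\<close>, which \<open>s = c / M\<^sup>2\<close> minimises.\<close>

lemma lipschitz_strongly_monotone_zero_exists:
  fixes r :: "'a::{real_inner, banach} \<Rightarrow> 'a"
  assumes c: "0 < c" and \<Lambda>: "0 < \<Lambda>"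
    and mono: "\<And>u v. c * (norm (u - v))\<^sup>2 \<le> (r u - r v) \<bullet> (u - v)"
    and lip: "\<And>u v. norm (r u - r v) \<le> \<Lambda> * norm (u - v)"
  shows "\<exists>!x. r x = 0"
proof -
  \<comment> \<open>Enlarging the Lipschitz constant beyond \<open>c\<close> keeps the contraction factor \<open>q\<close> positive.\<close>
  define M where "M = \<Lambda> + c"
  have M: "0 < M" "c < M" using c \<Lambda> by (auto simp: M_def)
  define s where "s = c / M\<^sup>2"
  have s: "0 < s" using c M by (simp add: s_def)
  define q where "q = sqrt (1 - (c / M)\<^sup>2)"
  have cM: "0 < c / M" "c / M < 1" using c M by auto
  then have q2: "0 < (c / M)\<^sup>2" "(c / M)\<^sup>2 < 1" by (auto simp: power_less_one_iff)
  have "\<exists>!x. x - s *\<^sub>R r x = x"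
  proof (rule banach_fix_type[of q]; (intro allI)?)
    show "0 \<le> q" "q < 1" using q2 by (auto simp: q_def)
    fix u v
    have "u - s *\<^sub>R r u - (v - s *\<^sub>R r v) = (u - v) - s *\<^sub>R (r u - r v)"
      by (simp add: algebra_simps)
    then have "(dist (u - s *\<^sub>R r u) (v - s *\<^sub>R r v))\<^sup>2
        = (norm (u - v))\<^sup>2 - 2 * s * ((r u - r v) \<bullet> (u - v)) + s\<^sup>2 * (norm (r u - r v))\<^sup>2"
      by (simp only: dist_norm power2_norm_diff_scaleR inner_commute)
    also have "\<dots> \<le> (norm (u - v))\<^sup>2 - 2 * s * (c * (norm (u - v))\<^sup>2) + s\<^sup>2 * (M * norm (u - v))\<^sup>2"
    proof (intro add_mono diff_left_mono mult_left_mono power_mono order_refl mono)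
      show "norm (r u - r v) \<le> M * norm (u - v)"
        using lip[of u v] c by (simp add: M_def distrib_right add_increasing2)
    qed (use s in auto)
    also have "\<dots> = (1 - (c / M)\<^sup>2) * (norm (u - v))\<^sup>2"
      using M by (simp add: s_def field_simps power2_eq_square)
    also have "\<dots> = (q * dist u v)\<^sup>2"
      using q2 by (simp add: q_def power_mult_distrib dist_norm)
    finally show "dist (u - s *\<^sub>R r u) (v - s *\<^sub>R r v) \<le> q * dist u v"
      by (rule power2_le_imp_le) (use q2 in \<open>simp add: q_def\<close>)
  qed
  then show ?thesis using s by simp
qed

section \<open>The residual of an inverse quasi-variational inequality\<close>

lemma closest_point_eq_iff:
  fixes S :: "'a::euclidean_space set"
  assumes "convex S" "closed S" "S \<noteq> {}"
  shows "closest_point S a = y \<longleftrightarrow> y \<in> S \<and> (\<forall>z\<in>S. (a - y) \<bullet> (z - y) \<le> 0)"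
proof
  assume "closest_point S a = y"
  then show "y \<in> S \<and> (\<forall>z\<in>S. (a - y) \<bullet> (z - y) \<le> 0)"
    using assms closest_point_in_set closest_point_dot by metis
next
  assume y: "y \<in> S \<and> (\<forall>z\<in>S. (a - y) \<bullet> (z - y) \<le> 0)"
  have "dist a y \<le> dist a z" if "z \<in> S" for z
  proof -
    have "(dist a z)\<^sup>2 = (dist a y)\<^sup>2 - 2 * ((a - y) \<bullet> (z - y)) + (dist y z)\<^sup>2"
      by (simp add: dist_norm power2_norm_eq_inner inner_diff inner_commute)
    moreover have "(a - y) \<bullet> (z - y) \<le> 0" using y that by blast
    ultimately have "(dist a y)\<^sup>2 \<le> (dist a z)\<^sup>2"
      using zero_le_power2[of "dist y z"] by linarith
    then show ?thesis by (rule power2_le_imp_le) simp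
  qed
  then show "closest_point S a = y"
    using closest_point_unique[of S y a] assms y by auto
qed

text \<open>A zero of the residual is a point whose image \<open>f u\<close> is the projection of \<open>f u - \<alpha> u\<close> onto
  \<open>\<Phi> u\<close>; the obtuse angle criterion for this projection is the variational inequality, scaled
  by \<open>\<alpha>\<close>.\<close>

lemma iqvip_solution_iff_residual_eq_0:
  fixes f :: "'a::euclidean_space \<Rightarrow> 'a"
  assumes "convex (\<Phi> u)" "closed (\<Phi> u)" "\<Phi> u \<noteq> {}" and "0 < \<alpha>"
  shows "iqvip_solution f \<Phi> u \<longleftrightarrow> iqvip_residual f \<Phi> \<alpha> u = 0"
proof -
  have "iqvip_residual f \<Phi> \<alpha> u = 0 \<longleftrightarrow> closest_point (\<Phi> u) (f u - \<alpha> *\<^sub>R u) = f u"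
    by (auto simp: iqvip_residual_def)
  also have "\<dots> \<longleftrightarrow> f u \<in> \<Phi> u \<and> (\<forall>y\<in>\<Phi> u. - (\<alpha> * (u \<bullet> (y - f u))) \<le> 0)"
    by (subst closest_point_eq_iff) (use assms in auto)
  also have "\<dots> \<longleftrightarrow> iqvip_solution f \<Phi> u"
    using \<open>0 < \<alpha>\<close> by (simp add: iqvip_solution_def zero_le_mult_iff)
  finally show ?thesis by simp
qed

text \<open>Strong monotonicity enters through the mixed term of the expanded square. If the radicand were
  negative, the domain would be trivial, and both sides would vanish.\<close>

lemma relaxation_lipschitz:
  fixes f :: "'a::euclidean_space \<Rightarrow> 'a"
  assumes f: "L-lipschitz_on UNIV f" "strongly_monotone \<beta> f" and "0 < \<alpha>"
  shows "norm ((f u - \<alpha> *\<^sub>R u) - (f v - \<alpha> *\<^sub>R v)) \<le> sqrt (L\<^sup>2 + \<alpha>\<^sup>2 - 2 * \<alpha> * \<beta>) * norm (u - v)"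
proof -
  have "(norm (f u - f v))\<^sup>2 \<le> (L * norm (u - v))\<^sup>2"
    using lipschitz_onD[OF f(1), of u v] by (intro power_mono) (auto simp: dist_norm)
  moreover have "\<alpha> * (\<beta> * (norm (u - v))\<^sup>2) \<le> \<alpha> * ((f u - f v) \<bullet> (u - v))"
    using f(2) \<open>0 < \<alpha>\<close> by (intro mult_left_mono) (auto simp: strongly_monotone_def)
  moreover have "(f u - \<alpha> *\<^sub>R u) - (f v - \<alpha> *\<^sub>R v) = (f u - f v) - \<alpha> *\<^sub>R (u - v)"
    by (simp add: algebra_simps)
  moreover note power2_norm_diff_scaleR[of "f u - f v" \<alpha> "u - v"]
  ultimately have "(norm ((f u - \<alpha> *\<^sub>R u) - (f v - \<alpha> *\<^sub>R v)))\<^sup>2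
      \<le> (L\<^sup>2 + \<alpha>\<^sup>2 - 2 * \<alpha> * \<beta>) * (norm (u - v))\<^sup>2"
    by (simp add: power_mult_distrib algebra_simps)
  then have "norm ((f u - \<alpha> *\<^sub>R u) - (f v - \<alpha> *\<^sub>R v))
      \<le> sqrt ((L\<^sup>2 + \<alpha>\<^sup>2 - 2 * \<alpha> * \<beta>) * (norm (u - v))\<^sup>2)"
    by (rule real_le_rsqrt)
  then show ?thesis by (simp add: real_sqrt_mult)
qed

lemma projection_part_lipschitz:
  fixes f :: "'a::euclidean_space \<Rightarrow> 'a"
  assumes "L-lipschitz_on UNIV f" "strongly_monotone \<beta> f" "0 < \<alpha>"
    and \<Phi>: "\<And>u. \<Phi> u \<noteq> {}" "\<And>u. closed (\<Phi> u)" "\<And>u. convex (\<Phi> u)"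
    and \<mu>: "\<And>u v w. norm (closest_point (\<Phi> u) w - closest_point (\<Phi> v) w) \<le> \<mu> * norm (u - v)"
  shows "norm (closest_point (\<Phi> u) (f u - \<alpha> *\<^sub>R u) - closest_point (\<Phi> v) (f v - \<alpha> *\<^sub>R v))
    \<le> (sqrt (L\<^sup>2 + \<alpha>\<^sup>2 - 2 * \<alpha> * \<beta>) + \<mu>) * norm (u - v)"
proof -
  let ?a = "f u - \<alpha> *\<^sub>R u" and ?b = "f v - \<alpha> *\<^sub>R v"
  have "norm (closest_point (\<Phi> u) ?a - closest_point (\<Phi> v) ?b)
      \<le> norm (closest_point (\<Phi> u) ?a - closest_point (\<Phi> u) ?b)
        + norm (closest_point (\<Phi> u) ?b - closest_point (\<Phi> v) ?b)"
    by norm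
  moreover have "norm (closest_point (\<Phi> u) ?a - closest_point (\<Phi> u) ?b) \<le> norm (?a - ?b)"
    using closest_point_lipschitz[OF \<Phi>(3,2,1), of u ?a ?b] by (simp add: dist_norm)
  ultimately show ?thesis
    using relaxation_lipschitz[OF assms(1-3), of u v] \<mu>[of u ?b v] by (simp add: distrib_right)
qed

theorem theorem3p2:
  fixes f :: "real ^ 'n \<Rightarrow> real ^ 'n"
    and \<Phi> :: "real ^ 'n \<Rightarrow> (real ^ 'n) set"
    and L \<alpha> \<beta> \<mu> \<sigma> \<gamma> :: real
  assumes "\<And>u. \<Phi> u \<noteq> {}" and "\<And>u. closed (\<Phi> u)" and "\<And>u. convex (\<Phi> u)"
    and "L-lipschitz_on UNIV f"
    and "\<beta> > 0" and "strongly_monotone \<beta> f"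
    and "\<alpha> > 0"
    and "\<mu> > 0"
    and "\<And>u v w. norm (closest_point (\<Phi> u) w - closest_point (\<Phi> v) w) \<le> \<mu> * norm (u - v)"
    and "sqrt (L\<^sup>2 + \<alpha>\<^sup>2 - 2 * \<alpha> * \<beta>) + \<mu> < \<alpha>"
    and "sqrt (L\<^sup>2 + \<alpha>\<^sup>2 - 2 * \<alpha> * \<beta>) + \<mu> < \<beta>"
    and "\<sigma> > 0" and "\<gamma> > 2"
  shows "(\<exists>!ustar. iqvip_solution f \<Phi> ustar) \<and>
    (\<forall>ustar. iqvip_solution f \<Phi> ustar \<longrightarrow>
       globally_finite_time_stable (iqvip_field f \<Phi> \<alpha> \<sigma> \<gamma>) ustar \<and>
       (\<exists>K p. K > 0 \<and> 0.5 < p \<and> p < 1 \<and>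
          (\<forall>T. settling_time_function (iqvip_field f \<Phi> \<alpha> \<sigma> \<gamma>) ustar UNIV T \<longrightarrow>
             (\<forall>u0. u0 \<noteq> ustar \<longrightarrow>
                T u0 \<le> 1 / 2 powr (1 - p) *
                         (norm (u0 - ustar) powr (2 * (1 - p)) / (K * (1 - p)))))))"
proof -
  define r where "r = iqvip_residual f \<Phi> \<alpha>"
  define \<delta> where "\<delta> = sqrt (L\<^sup>2 + \<alpha>\<^sup>2 - 2 * \<alpha> * \<beta>) + \<mu>"
  define c where "c = \<beta> - \<delta>"
  \<comment> \<open>The absolute value and the summand \<open>1\<close> make positivity immediate.\<close>
  define \<Lambda> where "\<Lambda> = L + \<bar>\<delta>\<bar> + 1"
  define \<theta> where "\<theta> = (\<gamma> - 2) / (\<gamma> - 1)"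
  have c: "0 < c" using assms(11) by (simp add: c_def \<delta>_def)
  have \<Lambda>: "0 < \<Lambda>" using lipschitz_on_nonneg[OF assms(4)] by (simp add: \<Lambda>_def)
  have \<theta>: "0 < \<theta>" "\<theta> < 1" using \<open>\<gamma> > 2\<close> by (auto simp: \<theta>_def)
  define P where "P u = closest_point (\<Phi> u) (f u - \<alpha> *\<^sub>R u)" for u
  have P: "norm (P u - P v) \<le> \<delta> * norm (u - v)" for u v
    unfolding P_def \<delta>_def by (rule projection_part_lipschitz) (use assms in auto)
  have r_diff: "r u - r v = (f u - f v) - (P u - P v)" for u v
    by (simp add: r_def iqvip_residual_def P_def)
  have mono: "c * (norm (u - v))\<^sup>2 \<le> (r u - r v) \<bullet> (u - v)" for u v
  proof -
    have "(P u - P v) \<bullet> (u - v) \<le> norm (P u - P v) * norm (u - v)"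
      by (rule norm_cauchy_schwarz)
    also have "\<dots> \<le> \<delta> * norm (u - v) * norm (u - v)"
      by (intro mult_right_mono P) auto
    finally have "(P u - P v) \<bullet> (u - v) \<le> \<delta> * (norm (u - v))\<^sup>2"
      by (simp add: power2_eq_square mult.assoc)
    moreover have "\<beta> * (norm (u - v))\<^sup>2 \<le> (f u - f v) \<bullet> (u - v)"
      using assms(6) by (simp add: strongly_monotone_def)
    ultimately show ?thesis
      by (simp add: r_diff c_def inner_diff_left left_diff_distrib)
  qed
  have lip: "norm (r u - r v) \<le> \<Lambda> * norm (u - v)" for u v
  proof -
    have "norm (r u - r v) \<le> norm (f u - f v) + norm (P u - P v)"
      unfolding r_diff by (rule norm_triangle_ineq4)
    also have "\<dots> \<le> L * norm (u - v) + \<delta> * norm (u - v)"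
      using lipschitz_onD[OF assms(4), of u v] P by (intro add_mono) (auto simp: dist_norm)
    also have "\<dots> \<le> \<Lambda> * norm (u - v)"
      unfolding \<Lambda>_def distrib_right[symmetric] by (intro mult_right_mono) auto
    finally show ?thesis .
  qed
  have sol_iff: "iqvip_solution f \<Phi> u \<longleftrightarrow> r u = 0" for u
    unfolding r_def by (rule iqvip_solution_iff_residual_eq_0) (use assms in auto)
  have "\<exists>!ustar. iqvip_solution f \<Phi> ustar"
    unfolding sol_iff by (rule lipschitz_strongly_monotone_zero_exists[OF c \<Lambda> mono lip])
  moreover have "globally_finite_time_stable (iqvip_field f \<Phi> \<alpha> \<sigma> \<gamma>) x \<and>
       (\<exists>K p. K > 0 \<and> 0.5 < p \<and> p < 1 \<and>
          (\<forall>T. settling_time_function (iqvip_field f \<Phi> \<alpha> \<sigma> \<gamma>) x UNIV T \<longrightarrow>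
             (\<forall>u0. u0 \<noteq> x \<longrightarrow>
                T u0 \<le> 1 / 2 powr (1 - p) *
                         (norm (u0 - x) powr (2 * (1 - p)) / (K * (1 - p))))))"
    if x: "iqvip_solution f \<Phi> x" for x
  proof -
    interpret strongly_monotone_zero r x c \<Lambda> \<sigma> \<theta>
      by unfold_locales (use c \<Lambda> \<theta> \<open>\<sigma> > 0\<close> mono lip x in \<open>auto simp: sol_iff\<close>)
    have field: "iqvip_field f \<Phi> \<alpha> \<sigma> \<gamma> = flow_field 0"
      by (simp add: fun_eq_iff iqvip_field_def flow_field_def damped_def Let_def flip: r_def \<theta>_def)
    \<comment> \<open>For these values the asserted bound is the one of \<open>settling_time_le\<close>: \<open>2 * (1 - p) = \<theta>\<close>.\<close>
    define p where "p = 1 - \<theta> / 2"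
    define K where "K = 2 * \<sigma> * c / (\<Lambda> powr \<theta> * 2 powr (1 - p))"
    have "T u0 \<le> 1 / 2 powr (1 - p) * (norm (u0 - x) powr (2 * (1 - p)) / (K * (1 - p)))"
      if "settling_time_function (flow_field 0) x UNIV T" "u0 \<noteq> x" for T u0
    proof -
      have "1 / 2 powr (1 - p) * (norm (u0 - x) powr (2 * (1 - p)) / (K * (1 - p)))
          = \<Lambda> powr \<theta> / (\<sigma> * c * \<theta>) * norm (u0 - x) powr \<theta>"
        using \<Lambda> \<open>\<sigma> > 0\<close> c \<theta> by (simp add: K_def p_def field_simps)
      then show ?thesis using settling_time_le[OF that] by simp
    qed
    moreover have "0 < K" "0.5 < p" "p < 1"
      using \<Lambda> \<open>\<sigma> > 0\<close> c \<theta> by (auto simp: K_def p_def)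
    ultimately show ?thesis
      unfolding field using globally_finite_time_stable_flow by blast
  qed
  ultimately show ?thesis by blast
qed

end
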